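(* Let $(c^{l,n}_{i,j})$, $l=1,\dots,M$, $n=0,1,2,\dots$, be ion concentrations computed by the hybrid scheme with periodic boundary conditions, i.e. satisfying for all $l,n,i,j$ $$\frac{c^{l,n+1}_{i,j}-c^{l,n}_{i,j}}{\Delta t}=-\frac{J^{l,n}_{i+\frac12,j}-J^{l,n}_{i-\frac12,j}}{\Delta x}-\frac{J^{l,n}_{i,j+\frac12}-J^{l,n}_{i,j-\frac12}}{\Delta y},$$ where the numerical fluxes $J^{l,n}$ are determined by the electric displacement values $D^n$ as specified in the context. Then, whatever the real values $D^n_{i+\frac12,j}$, $D^n_{i,j+\frac12}$ are (in particular, whatever values the neural network produces for the variable $\boldsymbol\Theta$ that enters their computation), the total mass of each species is conserved: for every $l\in\{1,\dots,M\}$ and every $n\ge 0$, $$\Delta x\,\Delta y\sum_{i,j}c^{l,n+1}_{i,j}=\Delta x\,\Delta y\sum_{i,j}c^{l,n}_{i,j}.$$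
   Context: The scheme is a finite-difference discretisation, on a two-dimensional uniform rectangular grid with $N_x\times N_y$ points ($N_x,N_y$ positive integers), of the Nernst--Planck equations $\partial_t c^l=-\nabla\cdot \boldsymbol J^l$, $\boldsymbol J^l=-(\nabla c^l-\frac{q^l c^l}{\epsilon}\boldsymbol D)$, $l=1,\dots,M$, where $c^l$ is the concentration and $q^l\in\mathbb Z$ the valence of the $l$-th ion species, $\epsilon>0$ is the permittivity (a function of position), and $\boldsymbol D$ is the electric displacement. Here $\Delta x,\Delta y,\Delta t>0$ are the grid sizes and the time step. Periodic boundary conditions mean that the index $i$ is taken modulo $N_x$ and $j$ modulo $N_y$, for grid-point quantities and for half-index (edge) quantities alike; sums over $i,j$ run over one period. Let $B(x)=\frac{x}{e^x-1}$ for $x\neq0$ and $B(0)=1$. The numerical fluxes are $$J^{l,n}_{i+\frac12,j}=-\frac1{\Delta x}\left(B\left(\Delta x\,q^l\frac{D^n_{i+\frac12,j}}{\epsilon_{i+\frac12,j}}\right)c^{l,n+1}_{i+1,j}-B\left(-\Delta x\,q^l\frac{D^n_{i+\frac12,j}}{\epsilon_{i+\frac12,j}}\right)c^{l,n+1}_{i,j}\right),$$ $$J^{l,n}_{i,j+\frac12}=-\frac1{\Delta y}\left(B\left(\Delta y\,q^l\frac{D^n_{i,j+\frac12}}{\epsilon_{i,j+\frac12}}\right)c^{l,n+1}_{i,j+1}-B\left(-\Delta y\,q^l\frac{D^n_{i,j+\frac12}}{\epsilon_{i,j+\frac12}}\right)c^{l,n+1}_{i,j}\right),$$ where $D^n_{i+\frac12,j}$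 and $D^n_{i,j+\frac12}$ are the edge values of the $x$- and $y$-components of the electric displacement at time step $n$, and $\epsilon_{i+\frac12,j},\epsilon_{i,j+\frac12}>0$ are edge values of the permittivity. In the hybrid method $D^n$ is obtained from a discretised Maxwell--Ampère equation $\partial_t\boldsymbol D=-\sum_l q^l\boldsymbol J^l+\boldsymbol\Theta$, with $\boldsymbol\Theta$ produced by a neural network; for the present result the edge values of $D^n$ are arbitrary real numbers. *)

theory Defs
  imports Complex_Main
begin

text \<open>Grid-point values u(i,j) and edge values are functions on int x int; an index taken modulo
  the number of grid points becomes periodicity. For x-edge quantities the index (i,j) stands
  for (i+1/2,j), for y-edge quantities it stands for (i,j+1/2).\<close>

definition grid_periodic :: "nat \<Rightarrow> nat \<Rightarrow> (int \<Rightarrow> int \<Rightarrow> real) \<Rightarrow> bool" where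
  "grid_periodic Nx Ny u \<longleftrightarrow>
     (\<forall>i j. u (i + int Nx) j = u i j \<and> u i (j + int Ny) = u i j)"

definition bernoulli_fun :: "real \<Rightarrow> real" where
  "bernoulli_fun x = (if x = 0 then 1 else x / (exp x - 1))"

text \<open>In both fluxes D and eps are edge values in the respective direction, q is the valence,
  and c is the concentration at the new time level.\<close>

definition flux_x ::
  "real \<Rightarrow> int \<Rightarrow> (int \<Rightarrow> int \<Rightarrow> real) \<Rightarrow> (int \<Rightarrow> int \<Rightarrow> real) \<Rightarrow> (int \<Rightarrow> int \<Rightarrow> real)
    \<Rightarrow> int \<Rightarrow> int \<Rightarrow> real" where
  "flux_x dx q eps D c i j =
     - (1 / dx) * (bernoulli_fun (dx * of_int q * (D i j / eps i j)) * c (i + 1) j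
                   - bernoulli_fun (- (dx * of_int q * (D i j / eps i j))) * c i j)"

definition flux_y ::
  "real \<Rightarrow> int \<Rightarrow> (int \<Rightarrow> int \<Rightarrow> real) \<Rightarrow> (int \<Rightarrow> int \<Rightarrow> real) \<Rightarrow> (int \<Rightarrow> int \<Rightarrow> real)
    \<Rightarrow> int \<Rightarrow> int \<Rightarrow> real" where
  "flux_y dy q eps D c i j =
     - (1 / dy) * (bernoulli_fun (dy * of_int q * (D i j / eps i j)) * c i (j + 1)
                   - bernoulli_fun (- (dy * of_int q * (D i j / eps i j))) * c i j)"

end

theory Submission
  imports Defs
begin

text \<open>The scheme is in conservation form: the flux through an edge enters the balances of the
  two adjacent cells with opposite signs. Summing the update over one period therefore leaves only
  end terms in each direction, and periodicity cancels them.
  \<open>sum_flux_divergence_periodic\<close> does this for arbitrary periodic edge functions;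
  \<open>flux_x_periodic\<close> and \<open>flux_y_periodic\<close> make it applicable to the
  numerical fluxes.\<close>

text \<open>The fluxes inherit the periodicity of the data, so the flux differences telescope to zero over
  one period in each direction, whatever the edge values are.\<close>

lemma sum_backward_diff_int:
  fixes g :: "int \<Rightarrow> 'a::ab_group_add"
  shows "(\<Sum>i = 0..<int n. g i - g (i - 1)) = g (int n - 1) - g (- 1)"
proof (induction n)
  case 0
  show ?case by simp
next
  case (Suc n)
  have "{0..<int (Suc n)} = insert (int n) {0..<int n}"
    by auto
  then show ?case
    using Suc.IH by simp
qed

text \<open>The two end terms left by telescoping sit at \<open>int n - 1\<close> and
  \<open>- 1\<close>, exactly one period apart.\<close>

lemma sum_backward_diff_periodic:
  fixes g :: "int \<Rightarrow> 'a::ab_group_add"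
  assumes "\<And>i. g (i + int n) = g i"
  shows "(\<Sum>i = 0..<int n. g i - g (i - 1)) = 0"
  using assms[of "- 1"] by (simp add: sum_backward_diff_int)

lemma flux_x_periodic:
  assumes "grid_periodic Nx Ny eps" "grid_periodic Nx Ny D" "grid_periodic Nx Ny c"
  shows "flux_x dx q eps D c (i + int Nx) j = flux_x dx q eps D c i j"
proof -
  \<comment> \<open>The flux also reads the right neighbour, so the period has to be moved past the
    \<open>+ 1\<close> before periodicity of \<open>c\<close> applies.\<close>
  have "c (i + int Nx + 1) j = c (i + 1) j"
    using assms(3) unfolding grid_periodic_def by (metis add.assoc add.commute)
  then show ?thesis
    using assms by (simp add: flux_x_def grid_periodic_def)
qed

lemma flux_y_periodic:
  assumes "grid_periodic Nx Ny eps" "grid_periodic Nx Ny D" "grid_periodic Nx Ny c"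
  shows "flux_y dy q eps D c i (j + int Ny) = flux_y dy q eps D c i j"
proof -
  have "c i (j + int Ny + 1) = c i (j + 1)"
    using assms(3) unfolding grid_periodic_def by (metis add.assoc add.commute)
  then show ?thesis
    using assms by (simp add: flux_y_def grid_periodic_def)
qed

text \<open>Each flux is differenced only in its own direction, so a period is asked of it only
  there.\<close>

lemma sum_flux_divergence_periodic:
  fixes F G :: "int \<Rightarrow> int \<Rightarrow> real"
  assumes F: "\<And>i j. F (i + int m) j = F i j"
    and G: "\<And>i j. G i (j + int n) = G i j"
  shows "(\<Sum>i = 0..<int m. \<Sum>j = 0..<int n.
           - (F i j - F (i - 1) j) / dx - (G i j - G i (j - 1)) / dy) = 0"
proof -
  have "(\<Sum>i = 0..<int m. \<Sum>j = 0..<int n. F i j - F (i - 1) j) = 0"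
    \<comment> \<open>The difference telescopes in \<open>i\<close>, the outer index; after swapping
      the sums, the inner one vanishes for each fixed \<open>j\<close>.\<close>
    by (subst sum.swap, intro sum.neutral ballI sum_backward_diff_periodic[where g = "\<lambda>i. F i j" for j] F)
  moreover have "(\<Sum>i = 0..<int m. \<Sum>j = 0..<int n. G i j - G i (j - 1)) = 0"
    by (simp add: sum_backward_diff_periodic G)
  moreover have "(\<Sum>i = 0..<int m. \<Sum>j = 0..<int n.
           - (F i j - F (i - 1) j) / dx - (G i j - G i (j - 1)) / dy)
      = - (\<Sum>i = 0..<int m. \<Sum>j = 0..<int n. F i j - F (i - 1) j) / dx
        - (\<Sum>i = 0..<int m. \<Sum>j = 0..<int n. G i j - G i (j - 1)) / dy"
    by (simp only: sum_subtractf sum_divide_distrib[symmetric] sum_negf)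
  ultimately show ?thesis
    by simp
qed

theorem mainTheorem1:
  fixes Nx Ny M :: nat
    and dx dy dt :: real
    and q :: "nat \<Rightarrow> int"
    and epsx epsy :: "int \<Rightarrow> int \<Rightarrow> real"
    and Dx Dy :: "nat \<Rightarrow> int \<Rightarrow> int \<Rightarrow> real"
    and c :: "nat \<Rightarrow> nat \<Rightarrow> int \<Rightarrow> int \<Rightarrow> real"
  assumes "Nx > 0" and "Ny > 0"
    and "dx > 0" and "dy > 0" and "dt > 0"
    and "\<And>i j. epsx i j > 0" and "\<And>i j. epsy i j > 0"
    and "grid_periodic Nx Ny epsx" and "grid_periodic Nx Ny epsy"
    and "\<And>n. grid_periodic Nx Ny (Dx n)" and "\<And>n. grid_periodic Nx Ny (Dy n)"
    and "\<And>l n. l \<in> {1..M} \<Longrightarrow> grid_periodic Nx Ny (c l n)"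
    and "\<And>l n i j. l \<in> {1..M} \<Longrightarrow>
           (c l (Suc n) i j - c l n i j) / dt =
             - (flux_x dx (q l) epsx (Dx n) (c l (Suc n)) i j
                - flux_x dx (q l) epsx (Dx n) (c l (Suc n)) (i - 1) j) / dx
             - (flux_y dy (q l) epsy (Dy n) (c l (Suc n)) i j
                - flux_y dy (q l) epsy (Dy n) (c l (Suc n)) i (j - 1)) / dy"
  shows "\<forall>l\<in>{1..M}. \<forall>n.
           dx * dy * (\<Sum>i = 0..<int Nx. \<Sum>j = 0..<int Ny. c l (Suc n) i j)
         = dx * dy * (\<Sum>i = 0..<int Nx. \<Sum>j = 0..<int Ny. c l n i j)"
proof (intro ballI allI)
  fix l n
  assume l: "l \<in> {1..M}"
  have "(\<Sum>i = 0..<int Nx. \<Sum>j = 0..<int Ny. (c l (Suc n) i j - c l n i j) / dt) = 0"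
    \<comment> \<open>The scheme turns the time difference into a discrete flux divergence. Its
      fluxes combine the displacement at level \<open>n\<close> with the concentration at level
      \<open>Suc n\<close>, both periodic.\<close>
    unfolding assms(13)[OF l]
    by (intro sum_flux_divergence_periodic flux_x_periodic flux_y_periodic) (use assms l in blast)+
  then have "(\<Sum>i = 0..<int Nx. \<Sum>j = 0..<int Ny. c l (Suc n) i j)
      = (\<Sum>i = 0..<int Nx. \<Sum>j = 0..<int Ny. c l n i j)"
    using \<open>dt > 0\<close> by (simp add: sum_divide_distrib[symmetric] sum_subtractf)
  then show "dx * dy * (\<Sum>i = 0..<int Nx. \<Sum>j = 0..<int Ny. c l (Suc n) i j)
      = dx * dy * (\<Sum>i = 0..<int Nx. \<Sum>j = 0..<int Ny. c l n i j)"
    by simp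
qed

end
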